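(* For every $n\in\mathbb{N}_0$, $${}_{T}B_{n}^{(c,v)}(x,y,z;\lambda)=\sum_{r=0}^n\binom{n}{r}\mathcal{U}_{r}(y)\,B_{n-r}^{(c,v)}(x,z;\lambda)$$ and $${}_{T}B_{n}^{(s,v)}(x,y,z;\lambda)=\sum_{r=0}^n\binom{n}{r}\mathcal{U}_{r}(y)\,B_{n-r}^{(s,v)}(x,z;\lambda).$$
   Context: $\mathbb{N}_0=\{0,1,2,\dots\}$; $x,y,z$ are variables (taking complex values) and $\lambda\in\mathbb{C}\setminus\{0\}$. Let $\mathcal{U}(y,t)=\sum_{n\ge0}\mathcal{U}_n(y)\frac{t^n}{n!}$ be a power series in $t$ with coefficients $\mathcal{U}_n(y)$ depending on $y$ and $\mathcal{U}_0(y)\neq0$; the 2-variable general polynomials $T_n(x,y)$ are defined by $e^{xt}\mathcal{U}(y,t)=\sum_{n\ge0}T_n(x,y)\frac{t^n}{n!}$, with the normalization $T_0(x,y)=1$. The order $v$ is such that $\bigl(\frac{t}{\lambda e^t-1}\bigr)^v$ is a power series in $t$ ($v\in\mathbb{N}_0$ in general; $v\in\mathbb{C}$ allowed when $\lambda=1$, with the branch $1^v=1$ at $t=0$). The parametric kinds of generalized Apostol--Bernoulli polynomials are defined, as power series in $t$, by $$\Bigl(\frac{t}{\lambda e^t-1}\Bigr)^v e^{xt}\,\mathcal{U}(y,t)\cos(zt)=\sum_{n=0}^\infty {}_{T}B_{n}^{(c,v)}(x,y,z;\lambda)\frac{t^n}{n!},$$ $$\Bigl(\frac{t}{\lambda e^t-1}\Bigr)^v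 e^{xt}\,\mathcal{U}(y,t)\sin(zt)=\sum_{n=0}^\infty {}_{T}B_{n}^{(s,v)}(x,y,z;\lambda)\frac{t^n}{n!}.$$ The two-variable parametric Apostol--Bernoulli polynomials $B_n^{(c,v)}(x,y;\lambda)$ and $B_n^{(s,v)}(x,y;\lambda)$ are defined by $$\Bigl(\frac{t}{\lambda e^t-1}\Bigr)^v e^{xt}\cos(yt)=\sum_{n=0}^\infty B_n^{(c,v)}(x,y;\lambda)\frac{t^n}{n!},\qquad \Bigl(\frac{t}{\lambda e^t-1}\Bigr)^v e^{xt}\sin(yt)=\sum_{n=0}^\infty B_n^{(s,v)}(x,y;\lambda)\frac{t^n}{n!}.$$ *)

theory Defs
  imports Complex_Main "HOL-Computational_Algebra.Formal_Power_Series"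
begin

text \<open>
  All generating functions are formal power series in \<open>t\<close> with complex coefficients,
  \<open>t\<close> being \<^term>\<open>fps_X\<close>. \<open>egf_coeff F n\<close> is the number \<open>a\<^sub>n\<close> in the expansion
  \<open>F = (\<Sum>n. a\<^sub>n t^n / n!)\<close>.
\<close>

definition egf_coeff :: "complex fps \<Rightarrow> nat \<Rightarrow> complex" where
  "egf_coeff F n = fact n * fps_nth F n"

lemma egf_coeff_unique:
  "F = Abs_fps (\<lambda>n. a n / fact n) \<longleftrightarrow> a = egf_coeff F"
  by (auto simp: egf_coeff_def fps_eq_iff fun_eq_iff field_simps)

definition U_series :: "(nat \<Rightarrow> complex \<Rightarrow> complex) \<Rightarrow> complex \<Rightarrow> complex fps" where
  "U_series U y = Abs_fps (\<lambda>n. U n y / fact n)"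

definition general_poly ::
  "(nat \<Rightarrow> complex \<Rightarrow> complex) \<Rightarrow> nat \<Rightarrow> complex \<Rightarrow> complex \<Rightarrow> complex" where
  "general_poly U n x y = egf_coeff (fps_exp x * U_series U y) n"

definition apostol_base :: "complex \<Rightarrow> complex fps" where
  "apostol_base lam = fps_X / (fps_const lam * fps_exp 1 - 1)"

text \<open>
  For \<open>lam = 1\<close> the denominator has zero constant term; the division is then the cancelling one
  of formal power series, as the following lemmas confirm.
\<close>

lemma apostol_denominator_nonzero: "fps_const lam * fps_exp 1 - 1 \<noteq> (0 :: complex fps)"
proof
  assume "fps_const lam * fps_exp 1 - 1 = (0 :: complex fps)"
  hence "fps_nth (fps_const lam * fps_exp 1 - 1 :: complex fps) 0 = 0"
    and "fps_nth (fps_const lam * fps_exp 1 - 1 :: complex fps) 1 = 0"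
    by simp_all
  thus False by simp
qed

lemma apostol_base_times_denominator:
  "apostol_base lam * (fps_const lam * fps_exp 1 - 1) = fps_X"
proof -
  let ?D = "fps_const lam * fps_exp 1 - 1 :: complex fps"
  have "subdegree ?D \<le> 1"
  proof (cases "lam = 0")
    case True
    hence "fps_nth ?D 0 \<noteq> 0" by simp
    thus ?thesis using subdegree_leI[of ?D 0] by simp
  next
    case False
    hence "fps_nth ?D 1 \<noteq> 0" by simp
    thus ?thesis by (rule subdegree_leI)
  qed
  hence "?D dvd fps_X"
    using apostol_denominator_nonzero[of lam] by (simp add: fps_dvd_iff)
  thus ?thesis by (simp add: apostol_base_def)
qed

lemma apostol_base_one_nth_0: "fps_nth (apostol_base 1) 0 = 1"
proof -
  have "fps_nth (apostol_base 1 * (fps_const 1 * fps_exp 1 - 1)) 1 = fps_nth fps_X 1"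
    by (simp only: apostol_base_times_denominator)
  thus ?thesis by (simp add: fps_mult_nth)
qed

text \<open>
  Power with complex exponent. For \<open>v\<close> a natural number it is the ordinary power. Otherwise it is
  the binomial series \<open>(\<Sum>k. (v gchoose k) * (F - 1)^k)\<close>, which is meaningful only if \<open>F\<close> has
  constant term 1, and then is the branch whose value at \<open>t = 0\<close> is 1.
\<close>

definition fps_cpower :: "complex fps \<Rightarrow> complex \<Rightarrow> complex fps" where
  "fps_cpower F v =
     (if v \<in> \<nat> then F ^ (THE k. v = of_nat k) else fps_binomial v oo (F - 1))"

lemma fps_cpower_of_nat [simp]: "fps_cpower F (of_nat k) = F ^ k"
  by (simp add: fps_cpower_def)

lemma fps_cpower_eq_binomial:
  assumes "fps_nth F 0 = 1"
  shows "fps_cpower F v = fps_binomial v oo (F - 1)"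
proof (cases "v \<in> \<nat>")
  case True
  then obtain k where k: "v = of_nat k" by (elim Nats_cases)
  have "fps_binomial v oo (F - 1) = ((1 + fps_X) oo (F - 1)) ^ k"
    using assms by (simp add: k fps_binomial_of_nat fps_compose_power)
  also have "(1 + fps_X) oo (F - 1) = F"
    using assms by (simp add: fps_compose_add_distrib)
  finally show ?thesis by (simp add: k)
qed (simp add: fps_cpower_def)

definition apostol_bernoulli_c ::
  "complex \<Rightarrow> nat \<Rightarrow> complex \<Rightarrow> complex \<Rightarrow> complex \<Rightarrow> complex" where
  "apostol_bernoulli_c v n x y lam =
     egf_coeff (fps_cpower (apostol_base lam) v * fps_exp x * fps_cos y) n"

definition apostol_bernoulli_s ::
  "complex \<Rightarrow> nat \<Rightarrow> complex \<Rightarrow> complex \<Rightarrow> complex \<Rightarrow> complex" where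
  "apostol_bernoulli_s v n x y lam =
     egf_coeff (fps_cpower (apostol_base lam) v * fps_exp x * fps_sin y) n"

definition general_apostol_bernoulli_c ::
  "(nat \<Rightarrow> complex \<Rightarrow> complex) \<Rightarrow> complex \<Rightarrow> nat \<Rightarrow>
   complex \<Rightarrow> complex \<Rightarrow> complex \<Rightarrow> complex \<Rightarrow> complex" where
  "general_apostol_bernoulli_c U v n x y z lam =
     egf_coeff (fps_cpower (apostol_base lam) v * fps_exp x * U_series U y * fps_cos z) n"

definition general_apostol_bernoulli_s ::
  "(nat \<Rightarrow> complex \<Rightarrow> complex) \<Rightarrow> complex \<Rightarrow> nat \<Rightarrow>
   complex \<Rightarrow> complex \<Rightarrow> complex \<Rightarrow> complex \<Rightarrow> complex" where
  "general_apostol_bernoulli_s U v n x y z lam =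
     egf_coeff (fps_cpower (apostol_base lam) v * fps_exp x * U_series U y * fps_sin z) n"

end

theory Submission
  imports Defs
begin

text \<open>Each generating function of the general family is that of the two-variable family, taken
  at \<open>x\<close> and \<open>z\<close>, times \<open>U_series U y\<close>. A product of
  exponential generating functions has as coefficients the binomial convolution of theirs
  (\<open>egf_coeff_mult\<close>), and those of \<open>U_series U y\<close> are the
  \<open>U r y\<close>.\<close>

lemma egf_coeff_mult:
  "egf_coeff (F * G) n = (\<Sum>r=0..n. of_nat (n choose r) * egf_coeff F r * egf_coeff G (n - r))"
proof -
  have "fact n * (fps_nth F r * fps_nth G (n - r)) =
          of_nat (n choose r) * egf_coeff F r * egf_coeff G (n - r)" if "r \<le> n" for r
    by (simp add: egf_coeff_def binomial_fact[OF that])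
  thus ?thesis
    \<comment> \<open>Only the coefficient of the product is unfolded; those of the factors stay
      folded, to match the termwise identity.\<close>
    unfolding egf_coeff_def[of "F * G"] fps_mult_nth sum_distrib_left
    by (intro sum.cong) auto
qed

lemma egf_coeff_U_series [simp]: "egf_coeff (U_series U y) n = U n y"
  by (simp add: egf_coeff_def U_series_def)

text \<open>Treats cosine and sine at once: \<open>P\<close> is the Apostol power times
  \<open>fps_exp x\<close>, and \<open>Q\<close> is \<open>fps_cos z\<close> or
  \<open>fps_sin z\<close>.\<close>

lemma egf_coeff_mult_U_series:
  "egf_coeff (P * U_series U y * Q) n =
     (\<Sum>r=0..n. of_nat (n choose r) * U r y * egf_coeff (P * Q) (n - r))"
proof -
  have "P * U_series U y * Q = U_series U y * (P * Q)"
    by (simp add: mult_ac)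
  thus ?thesis
    \<comment> \<open>Fixing the first factor keeps \<open>P * Q\<close> from being convolved in
      turn.\<close>
    by (simp only: egf_coeff_mult[of "U_series U y"] egf_coeff_U_series)
qed

theorem theorem3p2:
  fixes U :: "nat \<Rightarrow> complex \<Rightarrow> complex" and v lam x y z :: complex
  assumes "lam \<noteq> 0"
    and "v \<in> \<nat> \<or> lam = 1"
    and "\<And>y. U 0 y \<noteq> 0"
    and "\<And>x y. general_poly U 0 x y = 1"
  shows "\<forall>n. general_apostol_bernoulli_c U v n x y z lam =
               (\<Sum>r=0..n. of_nat (n choose r) * U r y * apostol_bernoulli_c v (n - r) x z lam)
           \<and> general_apostol_bernoulli_s U v n x y z lam =
               (\<Sum>r=0..n. of_nat (n choose r) * U r y * apostol_bernoulli_s v (n - r) x z lam)"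
  by (simp add: general_apostol_bernoulli_c_def general_apostol_bernoulli_s_def
      apostol_bernoulli_c_def apostol_bernoulli_s_def egf_coeff_mult_U_series)

end
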